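(* Let $\boldsymbol{\theta}=(\theta_{1},\dots,\theta_{s})\in\mathbb{R}^{s}$. The coordinates of $\boldsymbol{\theta}$ are algebraically independent (over $\mathbb{Q}$) if and only if the error map $$\varepsilon^{\mathrm{poly}}(\boldsymbol{\theta}):{}^{\ast}\mathbb{Z}[\boldsymbol{X}](\boldsymbol{\theta})\longrightarrow{}^{\ast}\mathbb{R}_{\varepsilon}$$ is injective.
   Context: Fix a non-principal ultrafilter on $\mathbb{N}$; ${}^{\ast}\mathbb{Z}\subset{}^{\ast}\mathbb{R}$ are the ultrapowers of $\mathbb{Z}$, $\mathbb{R}$ and ${}^{\ast}\mathbb{R}_{\varepsilon}$ is the group of infinitesimals. ${}^{\ast}\mathbb{Z}[\boldsymbol{X}]$, $\boldsymbol{X}=(X_{1},\dots,X_{s})$, is the ordinary polynomial ring with coefficients in ${}^{\ast}\mathbb{Z}$. Define ${}^{\ast}\mathbb{Z}[\boldsymbol{X}](\boldsymbol{\theta})=\{F\in{}^{\ast}\mathbb{Z}[\boldsymbol{X}]\mid F(\boldsymbol{\theta})\in{}^{\ast}\mathbb{R}_{\varepsilon}\}$ and $\varepsilon^{\mathrm{poly}}(\boldsymbol{\theta})(F)=F(\boldsymbol{\theta})$. *)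

theory Defs
  imports "HOL-Analysis.Analysis" "HOL-Library.Function_Algebras" "HOL-Algebra.Algebra"
    "HOL-Algebra.Algebraic_Closure_Type"
begin

subsection \<open>Non-principal ultrafilters\<close>

definition nonprincipal_ultrafilter :: "'a filter \<Rightarrow> bool" where
  "nonprincipal_ultrafilter U \<longleftrightarrow>
     U \<noteq> bot \<and>
     (\<forall>P. eventually P U \<or> eventually (\<lambda>x. \<not> P x) U) \<and>
     (\<forall>A. U \<noteq> principal A)"


subsection \<open>Polynomials in several variables\<close>

text \<open>
  As in \<^theory>\<open>HOL-Algebra.Indexed_Polynomials\<close>, a monomial is a multiset of variables and a
  polynomial is its coefficient function. The polynomials with variables in \<open>I\<close> and coefficients
  in \<open>K \<subseteq> carrier R\<close> form the set \<open>ring.indexed_pset R I K\<close>. They have finite support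
  (see \<open>finite_support_indexed_pset\<close> below), so the sum in \<open>indexed_value\<close> is a finite one.
\<close>

definition indexed_value ::
    "('a, 'm) ring_scheme \<Rightarrow> ('c \<Rightarrow> 'a) \<Rightarrow> ('c multiset \<Rightarrow> 'a) \<Rightarrow> 'a" where
  "indexed_value R x P =
     (\<Oplus>\<^bsub>R\<^esub>m\<in>{m. P m \<noteq> \<zero>\<^bsub>R\<^esub>}.
        P m \<otimes>\<^bsub>R\<^esub> (\<Otimes>\<^bsub>R\<^esub>i\<in>set_mset m. x i [^]\<^bsub>R\<^esub> count m i))"

text \<open>
  Algebraic independence over \<open>K\<close> of the family \<open>(x i)\<close>, \<open>i \<in> I\<close> (a family with a repeated entry
  is dependent).
\<close>

definition algebraically_independent ::
    "('a, 'm) ring_scheme \<Rightarrow> 'a set \<Rightarrow> 'c set \<Rightarrow> ('c \<Rightarrow> 'a) \<Rightarrow> bool" where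
  "algebraically_independent R K I x \<longleftrightarrow>
     (\<forall>P\<in>ring.indexed_pset R I K. indexed_value R x P = \<zero>\<^bsub>R\<^esub> \<longrightarrow> P = (\<lambda>m. \<zero>\<^bsub>R\<^esub>))"

lemma (in ring) finite_support_indexed_pset:
  assumes "P \<in> indexed_pset I K"
  shows "finite {m. P m \<noteq> \<zero>}"
  using assms
proof (induction rule: indexed_pset.induct)
  case (indexed_const k)
  have "{m. (indexed_const k :: _ multiset \<Rightarrow> 'a) m \<noteq> \<zero>} \<subseteq> {{#}}"
    by (auto simp: indexed_const_def)
  then show ?case
    by (rule finite_subset) simp
next
  case (indexed_padd P Q)
  have "{m. indexed_padd P Q m \<noteq> \<zero>} \<subseteq> {m. P m \<noteq> \<zero>} \<union> {m. Q m \<noteq> \<zero>}"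
    by (auto simp: indexed_padd_def)
  then show ?case
    by (rule finite_subset) (use indexed_padd in simp)
next
  case (indexed_pmult P i)
  have "{m. indexed_pmult P i m \<noteq> \<zero>} \<subseteq> add_mset i ` {m. P m \<noteq> \<zero>}"
  proof
    fix m assume "m \<in> {m. indexed_pmult P i m \<noteq> \<zero>}"
    then have "i \<in># m" "P (m - {#i#}) \<noteq> \<zero>"
      by (auto simp: indexed_pmult_def split: if_splits)
    then show "m \<in> add_mset i ` {m. P m \<noteq> \<zero>}"
      by (intro image_eqI[of _ _ "m - {#i#}"]) auto
  qed
  then show ?case
    by (rule finite_subset) (use indexed_pmult in simp)
qed


subsection \<open>The ultrapowers of the reals and of the integers\<close>

text \<open>
  The ultrapower of \<open>\<real>\<close> is the ring of real sequences, with pointwise operations, modulo the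
  sequences that vanish almost everywhere; by \<open>hyperreal_class_def'\<close> below its elements
  are the classes of sequences for the relation of being equal almost everywhere.
\<close>

definition null_seqs :: "nat filter \<Rightarrow> (nat \<Rightarrow> real) set" where
  "null_seqs U = {f. eventually (\<lambda>n. f n = 0) U}"

definition hyperreal :: "nat filter \<Rightarrow> (nat \<Rightarrow> real) set ring" where
  "hyperreal U = ring_of_type_algebra Quot null_seqs U"

definition hyperreal_class :: "nat filter \<Rightarrow> (nat \<Rightarrow> real) \<Rightarrow> (nat \<Rightarrow> real) set" where
  "hyperreal_class U f = null_seqs U +>\<^bsub>ring_of_type_algebra\<^esub> f"

definition hyperreal_of_real :: "nat filter \<Rightarrow> real \<Rightarrow> (nat \<Rightarrow> real) set" where
  "hyperreal_of_real U r = hyperreal_class U (\<lambda>n. r)"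

text \<open>The ultrapower of \<open>\<int>\<close>, with its canonical identification as a subring of that of \<open>\<real>\<close>.\<close>

definition hyperint :: "nat filter \<Rightarrow> (nat \<Rightarrow> real) set set" where
  "hyperint U = {hyperreal_class U (\<lambda>n. of_int (k n)) | k :: nat \<Rightarrow> int. True}"

definition hyperreal_less ::
    "nat filter \<Rightarrow> (nat \<Rightarrow> real) set \<Rightarrow> (nat \<Rightarrow> real) set \<Rightarrow> bool" where
  "hyperreal_less U x y \<longleftrightarrow> (\<exists>f\<in>x. \<exists>g\<in>y. eventually (\<lambda>n. f n < g n) U)"

definition infinitesimals :: "nat filter \<Rightarrow> (nat \<Rightarrow> real) set set" where
  "infinitesimals U =
     {x \<in> carrier (hyperreal U). \<forall>r>0.
        hyperreal_less U (hyperreal_of_real U (- r)) x \<and>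
        hyperreal_less U x (hyperreal_of_real U r)}"

lemma ideal_null_seqs: "ideal (null_seqs U) ring_of_type_algebra"
proof (intro idealI ring_from_type_algebra subgroup.intro)
  let ?R = "ring_of_type_algebra :: (nat \<Rightarrow> real) ring"
  interpret R: ring ?R
    by (rule ring_from_type_algebra)
  show "null_seqs U \<subseteq> carrier (add_monoid ?R)"
    by (simp add: ring_of_type_algebra_def)
  show "x \<otimes>\<^bsub>add_monoid ?R\<^esub> y \<in> null_seqs U" if "x \<in> null_seqs U" "y \<in> null_seqs U" for x y
    using that unfolding null_seqs_def ring_of_type_algebra_def by (auto elim: eventually_elim2)
  show "\<one>\<^bsub>add_monoid ?R\<^esub> \<in> null_seqs U"
    by (simp add: null_seqs_def ring_of_type_algebra_def)
  show "m_inv (add_monoid ?R) x \<in> null_seqs U" if "x \<in> null_seqs U" for x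
  proof -
    have "\<ominus>\<^bsub>?R\<^esub> x = - x"
      by (rule R.minus_equality) (simp_all add: ring_of_type_algebra_def)
    then show ?thesis
      using that by (simp add: null_seqs_def a_inv_def)
  qed
  show "x \<otimes>\<^bsub>?R\<^esub> a \<in> null_seqs U" "a \<otimes>\<^bsub>?R\<^esub> x \<in> null_seqs U" if "a \<in> null_seqs U" for a x
    using that unfolding null_seqs_def ring_of_type_algebra_def by (auto elim: eventually_mono)
qed

lemma cring_hyperreal: "cring (hyperreal U)"
  unfolding hyperreal_def
  by (rule ideal.quotient_is_cring[OF ideal_null_seqs cring_from_type_algebra])

lemma carrier_hyperreal: "carrier (hyperreal U) = range (hyperreal_class U)"
  by (auto simp: hyperreal_def hyperreal_class_def FactRing_def A_RCOSETS_def'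
      ring_of_type_algebra_def)

lemma hyperreal_class_ring_hom:
  "hyperreal_class U \<in> ring_hom ring_of_type_algebra (hyperreal U)"
  unfolding hyperreal_def hyperreal_class_def[abs_def]
  by (rule ideal.rcos_ring_hom[OF ideal_null_seqs])

lemma hyperreal_class_def': "hyperreal_class U f = {g. eventually (\<lambda>n. g n = f n) U}"
proof -
  have "g \<in> hyperreal_class U f \<longleftrightarrow> eventually (\<lambda>n. g n = f n) U" for g
  proof
    assume "g \<in> hyperreal_class U f"
    then obtain h where "h \<in> null_seqs U" "g = h + f"
      by (auto simp: hyperreal_class_def a_r_coset_def' ring_of_type_algebra_def)
    then show "eventually (\<lambda>n. g n = f n) U"
      by (auto simp: null_seqs_def)
  next
    assume "eventually (\<lambda>n. g n = f n) U"
    then have "g - f \<in> null_seqs U"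
      by (simp add: null_seqs_def)
    moreover have "g = (g - f) + f"
      by simp
    ultimately show "g \<in> hyperreal_class U f"
      unfolding hyperreal_class_def a_r_coset_def' ring_of_type_algebra_def by fastforce
  qed
  then show ?thesis
    by auto
qed

lemma hyperreal_class_eq_iff:
  "hyperreal_class U f = hyperreal_class U g \<longleftrightarrow> eventually (\<lambda>n. f n = g n) U"
proof
  assume "hyperreal_class U f = hyperreal_class U g"
  then have "f \<in> hyperreal_class U g"
    by (auto simp: hyperreal_class_def')
  then show "eventually (\<lambda>n. f n = g n) U"
    by (simp add: hyperreal_class_def')
next
  assume "eventually (\<lambda>n. f n = g n) U"
  then show "hyperreal_class U f = hyperreal_class U g"
    unfolding hyperreal_class_def' by (auto elim: eventually_elim2)
qed

lemma subring_hyperint: "subring (hyperint U) (hyperreal U)"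
proof -
  let ?R = "ring_of_type_algebra :: (nat \<Rightarrow> real) ring"
  let ?Z = "{\<lambda>n. real_of_int (k n) | k :: nat \<Rightarrow> int. True}"
  interpret R: ring ?R
    by (rule ring_from_type_algebra)
  have Z: "subring ?Z ?R"
  proof (rule R.subringI)
    show "?Z \<subseteq> carrier ?R"
      by (simp add: ring_of_type_algebra_def)
    show "\<one>\<^bsub>?R\<^esub> \<in> ?Z"
      by (simp add: ring_of_type_algebra_def fun_eq_iff exI[of _ "\<lambda>_. 1"])
    show "\<ominus>\<^bsub>?R\<^esub> f \<in> ?Z" if f: "f \<in> ?Z" for f
    proof -
      have "\<ominus>\<^bsub>?R\<^esub> f = - f"
        by (rule R.minus_equality) (simp_all add: ring_of_type_algebra_def)
      moreover obtain k where "f = (\<lambda>n. real_of_int (k n))"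
        using f by blast
      ultimately have "\<ominus>\<^bsub>?R\<^esub> f = (\<lambda>n. real_of_int (- k n))"
        by (metis fun_Compl_def of_int_minus)
      then show ?thesis
        by (intro CollectI exI[of _ "\<lambda>n. - k n"]) simp
    qed
    show "f \<otimes>\<^bsub>?R\<^esub> g \<in> ?Z" "f \<oplus>\<^bsub>?R\<^esub> g \<in> ?Z" if fg: "f \<in> ?Z" "g \<in> ?Z" for f g
    proof -
      obtain k l where "f = (\<lambda>n. real_of_int (k n))" "g = (\<lambda>n. real_of_int (l n))"
        using fg by blast
      then have eqs: "f \<otimes>\<^bsub>?R\<^esub> g = (\<lambda>n. real_of_int (k n * l n))"
        "f \<oplus>\<^bsub>?R\<^esub> g = (\<lambda>n. real_of_int (k n + l n))"
        by (simp_all add: ring_of_type_algebra_def fun_eq_iff)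
      show "f \<otimes>\<^bsub>?R\<^esub> g \<in> ?Z"
        unfolding eqs by (intro CollectI exI[of _ "\<lambda>n. k n * l n"]) simp
      show "f \<oplus>\<^bsub>?R\<^esub> g \<in> ?Z"
        unfolding eqs by (intro CollectI exI[of _ "\<lambda>n. k n + l n"]) simp
    qed
  qed
  have "ring (hyperreal U)"
    using cring_hyperreal by (rule cring.axioms(1))
  then have "ring_hom_ring ?R (hyperreal U) (hyperreal_class U)"
    using R.ring_axioms hyperreal_class_ring_hom by (intro ring_hom_ringI2)
  then have "subring (hyperreal_class U ` ?Z) (hyperreal U)"
    using Z by (rule ring_hom_ring.img_is_subring)
  also have "hyperreal_class U ` ?Z = hyperint U"
    by (auto simp: hyperint_def)
  finally show ?thesis .
qed


subsection \<open>The polynomial error map\<close>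

definition hyperint_polys :: "nat filter \<Rightarrow> ('s multiset \<Rightarrow> (nat \<Rightarrow> real) set) set" where
  "hyperint_polys U = ring.indexed_pset (hyperreal U) UNIV (hyperint U)"

definition error_poly ::
    "nat filter \<Rightarrow> real ^ 's \<Rightarrow> ('s multiset \<Rightarrow> (nat \<Rightarrow> real) set) \<Rightarrow> (nat \<Rightarrow> real) set" where
  "error_poly U \<theta> F = indexed_value (hyperreal U) (\<lambda>i. hyperreal_of_real U (\<theta> $ i)) F"

definition diophantine_polys ::
    "nat filter \<Rightarrow> real ^ 's \<Rightarrow> ('s multiset \<Rightarrow> (nat \<Rightarrow> real) set) set" where
  "diophantine_polys U \<theta> = {F \<in> hyperint_polys U. error_poly U \<theta> F \<in> infinitesimals U}"

end

theory Submission
  imports Defs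
begin

text \<open>
  The theorem holds because a polynomial over the ultrapower has only finitely many coefficients, so
  evaluation at a standard point commutes with passing to representatives. If the coefficients of
  \<open>F\<close> are the classes of integer sequences \<open>k m\<close>, then \<open>F(\<theta>)\<close> is the class of the sequence whose
  \<open>n\<close>-th term is the value at \<open>\<theta>\<close> of the ordinary integer polynomial with coefficients \<open>k m n\<close>
  (lemma \<open>error_poly_class\<close>). Both the class map and evaluation at an index \<open>n\<close> are ring
  homomorphisms on the ring of real sequences, and \<open>indexed_value\<close> commutes with ring homomorphisms
  (lemma \<open>indexed_value_hom\<close>).

  If the coordinates of \<open>\<theta>\<close> are algebraically independent, then distinct rational polynomials have
  distinct values at \<open>\<theta>\<close>. So \<open>F(\<theta>) = G(\<theta>)\<close> makes the \<open>n\<close>-th integer polynomials of \<open>F\<close> and \<open>G\<close>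
  equal for almost all \<open>n\<close>, that is, \<open>F = G\<close>. Conversely, a rational relation of \<open>\<theta>\<close> becomes an
  integer relation after clearing denominators. Read with constant sequences as coefficients, it has
  the same value \<open>0\<close> as the zero polynomial. As \<open>0\<close> is infinitesimal, injectivity makes all the
  coefficients zero.
\<close>


section \<open>Values of polynomials in several variables\<close>

text \<open>
  Induction on a finite set containing the support: a coefficient function is a single term plus a
  function with one monomial fewer, and a single term is a constant multiplied by variables.
\<close>

lemma (in ring) indexed_pset_UNIV_I:
  fixes P :: "'c multiset \<Rightarrow> 'a"
  assumes K: "subring K R" and fin: "finite S"
    and P: "\<And>m. P m \<in> K" "\<And>m. m \<notin> S \<Longrightarrow> P m = \<zero>"
  shows "P \<in> indexed_pset UNIV K"
  using fin P
proof (induction S arbitrary: P rule: finite_induct)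
  case empty
  then have "P = indexed_const \<zero>"
    by (simp add: indexed_const_def fun_eq_iff)
  then show ?case
    using subringE(2)[OF K] by (simp add: indexed_pset.indexed_const)
next
  case (insert m0 S)
  let ?mono = "\<lambda>c m0 m. if m = m0 then c else \<zero>"
  have mono: "?mono c m0 \<in> indexed_pset UNIV K" if "c \<in> K" for c and m0 :: "'c multiset"
  proof (induction m0)
    case empty
    have eq: "?mono c {#} = indexed_const c"
      by (simp add: indexed_const_def fun_eq_iff)
    show ?case
      unfolding eq using that by (rule indexed_pset.indexed_const)
  next
    case (add i m0)
    have "?mono c (add_mset i m0) = indexed_pmult (?mono c m0) i"
    proof
      fix m
      have "m - {#i#} = m0 \<longleftrightarrow> m = add_mset i m0" if "i \<in># m"
        using that by auto
      moreover have "i \<in># m" if "m = add_mset i m0"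
        using that by simp
      ultimately show "?mono c (add_mset i m0) m = indexed_pmult (?mono c m0) i m"
        unfolding indexed_pmult_def by auto
    qed
    then show ?case
      using indexed_pset.indexed_pmult[OF add UNIV_I] by simp
  qed
  have rest: "(P(m0 := \<zero>)) \<in> indexed_pset UNIV K"
    by (rule insert.IH) (use insert.prems subringE(2)[OF K] in auto)
  have "P = indexed_padd (?mono (P m0) m0) (P(m0 := \<zero>))"
    using subsetD[OF subringE(1)[OF K] insert.prems(1)]
    by (simp add: indexed_padd_def fun_eq_iff)
  then show ?case
    using indexed_pset.indexed_padd[OF mono rest] insert.prems(1) by metis
qed

text \<open>
  This replaces the inductive description of polynomials by coefficient functions, which can be
  modified one coefficient at a time: differences, clearing of denominators and choice of
  representatives all act coefficientwise.
\<close>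

lemma (in ring) indexed_pset_UNIV_iff:
  fixes P :: "'c multiset \<Rightarrow> 'a"
  assumes K: "subring K R"
  shows "P \<in> indexed_pset UNIV K \<longleftrightarrow> finite {m. P m \<noteq> \<zero>} \<and> (\<forall>m. P m \<in> K)"
proof
  assume P: "P \<in> indexed_pset UNIV K"
  then have "\<forall>m. P m \<in> K"
    by induction
      (use subringE[OF K] in \<open>auto simp: indexed_const_def indexed_padd_def indexed_pmult_def\<close>)
  then show "finite {m. P m \<noteq> \<zero>} \<and> (\<forall>m. P m \<in> K)"
    using finite_support_indexed_pset[OF P] by blast
next
  assume "finite {m. P m \<noteq> \<zero>} \<and> (\<forall>m. P m \<in> K)"
  then show "P \<in> indexed_pset UNIV K"
    by (intro indexed_pset_UNIV_I[OF K, of "{m. P m \<noteq> \<zero>}"]) auto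
qed

lemma (in cring) monomial_value_closed:
  assumes "\<And>i. x i \<in> carrier R"
  shows "(\<Otimes>i\<in>set_mset m. x i [^] count m i) \<in> carrier R"
  using assms by (intro finprod_closed) auto

text \<open>
  The support of a sum or of a homomorphic image can be smaller than expected, so values are
  compared as sums over a common finite set of monomials.
\<close>

lemma (in cring) indexed_value_superset:
  assumes "finite S" "\<And>m. m \<notin> S \<Longrightarrow> P m = \<zero>"
    and "\<And>m. P m \<in> carrier R" "\<And>i. x i \<in> carrier R"
  shows "indexed_value R x P =
    (\<Oplus>m\<in>S. P m \<otimes> (\<Otimes>i\<in>set_mset m. x i [^] count m i))"
  unfolding indexed_value_def
  by (rule add.finprod_mono_neutral_cong_left)
    (use assms monomial_value_closed[of x] in auto)

lemma (in cring) indexed_value_add: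
  assumes "finite {m. P m \<noteq> \<zero>}" "finite {m. Q m \<noteq> \<zero>}"
    and "\<And>m. P m \<in> carrier R" "\<And>m. Q m \<in> carrier R" "\<And>i. x i \<in> carrier R"
  shows "indexed_value R x (\<lambda>m. P m \<oplus> Q m) = indexed_value R x P \<oplus> indexed_value R x Q"
proof -
  let ?S = "{m. P m \<noteq> \<zero>} \<union> {m. Q m \<noteq> \<zero>}"
  have "indexed_value R x F =
      (\<Oplus>m\<in>?S. F m \<otimes> (\<Otimes>i\<in>set_mset m. x i [^] count m i))"
    if "\<And>m. m \<notin> ?S \<Longrightarrow> F m = \<zero>" "\<And>m. F m \<in> carrier R" for F
    by (rule indexed_value_superset) (use assms that in auto)
  then show ?thesis
    using assms monomial_value_closed[of x] by (simp add: l_distr finsum_addf Pi_def)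
qed

lemma (in cring) indexed_value_smult:
  assumes "finite {m. P m \<noteq> \<zero>}"
    and "c \<in> carrier R" "\<And>m. P m \<in> carrier R" "\<And>i. x i \<in> carrier R"
  shows "indexed_value R x (\<lambda>m. c \<otimes> P m) = c \<otimes> indexed_value R x P"
proof -
  let ?S = "{m. P m \<noteq> \<zero>}"
  have "indexed_value R x F =
      (\<Oplus>m\<in>?S. F m \<otimes> (\<Otimes>i\<in>set_mset m. x i [^] count m i))"
    if "\<And>m. m \<notin> ?S \<Longrightarrow> F m = \<zero>" "\<And>m. F m \<in> carrier R" for F
    by (rule indexed_value_superset) (use assms that in auto)
  then show ?thesis
    using assms monomial_value_closed[of x] by (simp add: m_assoc finsum_rdistr Pi_def)
qed

lemma (in cring) indexed_value_closed:
  assumes "\<And>m. P m \<in> carrier R" "\<And>i. x i \<in> carrier R"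
  shows "indexed_value R x P \<in> carrier R"
  unfolding indexed_value_def
  using assms monomial_value_closed[of x] by (intro finsum_closed) auto

lemma (in ring_hom_cring) indexed_value_hom:
  assumes "finite {m. P m \<noteq> \<zero>\<^bsub>R\<^esub>}"
    and "\<And>m. P m \<in> carrier R" "\<And>i. x i \<in> carrier R"
  shows "h (indexed_value R x P) = indexed_value S (\<lambda>i. h (x i)) (\<lambda>m. h (P m))"
proof -
  let ?A = "{m. P m \<noteq> \<zero>\<^bsub>R\<^esub>}"
  have pow: "h (y [^]\<^bsub>R\<^esub> (k::nat)) = h y [^]\<^bsub>S\<^esub> k" if "y \<in> carrier R" for y k
    using that by (induction k) auto
  have mon: "h (\<Otimes>\<^bsub>R\<^esub>i\<in>set_mset m. x i [^]\<^bsub>R\<^esub> count m i) =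
      (\<Otimes>\<^bsub>S\<^esub>i\<in>set_mset m. h (x i) [^]\<^bsub>S\<^esub> count m i)" for m
    using assms by (subst hom_finprod) (auto simp: pow o_def)
  have "h (indexed_value R x P) =
      (\<Oplus>\<^bsub>S\<^esub>m\<in>?A. h (P m) \<otimes>\<^bsub>S\<^esub> (\<Otimes>\<^bsub>S\<^esub>i\<in>set_mset m. h (x i) [^]\<^bsub>S\<^esub> count m i))"
    unfolding indexed_value_def
    using assms R.monomial_value_closed[of x] by (subst hom_finsum) (auto simp: o_def mon)
  also have "\<dots> = indexed_value S (\<lambda>i. h (x i)) (\<lambda>m. h (P m))"
    by (rule S.indexed_value_superset[symmetric]) (use assms in auto)
  finally show ?thesis .
qed

text \<open>
  Independence is a statement about the kernel of evaluation; evaluation is additive, so a trivial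
  kernel makes it injective.
\<close>

lemma (in cring) algebraically_independent_imp_inj:
  fixes x :: "'c \<Rightarrow> 'a"
  assumes K: "subring K R" and x: "\<And>i. x i \<in> carrier R"
    and indep: "algebraically_independent R K UNIV x"
  shows "inj_on (indexed_value R x) (indexed_pset UNIV K)"
proof (rule inj_onI)
  fix P Q :: "'c multiset \<Rightarrow> 'a"
  assume "P \<in> indexed_pset UNIV K" "Q \<in> indexed_pset UNIV K"
  then have fin: "finite {m. P m \<noteq> \<zero>}" "finite {m. Q m \<noteq> \<zero>}" and PK: "\<And>m. P m \<in> K"
    and QK: "\<And>m. Q m \<in> K"
    by (auto simp: indexed_pset_UNIV_iff[OF K])
  have PR: "P m \<in> carrier R" and QR: "Q m \<in> carrier R" for m
    using PK QK subringE(1)[OF K] by auto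
  assume eq: "indexed_value R x P = indexed_value R x Q"
  define D where "D = (\<lambda>m. P m \<ominus> Q m)"
  have DK: "D m \<in> K" for m
    using PK QK subringE(5,7)[OF K] by (simp add: D_def a_minus_def)
  have DR: "D m \<in> carrier R" for m
    using DK subringE(1)[OF K] by auto
  have "{m. D m \<noteq> \<zero>} \<subseteq> {m. P m \<noteq> \<zero>} \<union> {m. Q m \<noteq> \<zero>}"
    by (auto simp: D_def a_minus_def)
  then have finD: "finite {m. D m \<noteq> \<zero>}"
    by (rule finite_subset) (use fin in simp)
  have "P = (\<lambda>m. D m \<oplus> Q m)"
    using PR QR by (simp add: D_def a_minus_def a_assoc l_neg)
  then have "indexed_value R x P = indexed_value R x D \<oplus> indexed_value R x Q"
    using indexed_value_add[OF finD fin(2) DR QR x] by simp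
  with eq have "indexed_value R x D = \<zero>"
    using indexed_value_closed[of D x, OF DR x] indexed_value_closed[of Q x, OF QR x]
    by (metis add.r_cancel_one)
  moreover have "D \<in> indexed_pset UNIV K"
    using finD DK by (simp add: indexed_pset_UNIV_iff[OF K])
  ultimately have "D m = \<zero>" for m
    using indep unfolding algebraically_independent_def by metis
  then show "P = Q"
    using PR QR by (auto simp: D_def fun_eq_iff)
qed


section \<open>Rational and integer relations\<close>

lemma subring_Rats: "subring \<rat> (ring_of_type_algebra :: real ring)"
proof -
  let ?R = "ring_of_type_algebra :: real ring"
  interpret R: ring ?R
    by (rule ring_from_type_algebra)
  show ?thesis
  proof (rule R.subringI)
    show "\<ominus>\<^bsub>?R\<^esub> q \<in> \<rat>" if "q \<in> \<rat>" for q
    proof -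
      have "\<ominus>\<^bsub>?R\<^esub> q = - q"
        by (rule R.minus_equality) (simp_all add: ring_of_type_algebra_def)
      then show ?thesis
        using that by simp
    qed
  qed (auto simp: ring_of_type_algebra_def)
qed

lemma finite_rats_common_denominator:
  fixes f :: "'a \<Rightarrow> real"
  assumes "finite S" "\<And>m. f m \<in> \<rat>"
  shows "\<exists>N::int. N \<noteq> 0 \<and> (\<forall>m\<in>S. of_int N * f m \<in> \<int>)"
  using assms(1)
proof induction
  case empty
  then show ?case
    by (auto intro: exI[of _ 1])
next
  case (insert a S)
  then obtain N :: int where N: "N \<noteq> 0" "\<And>m. m \<in> S \<Longrightarrow> of_int N * f m \<in> \<int>"
    by auto
  obtain p q :: int where pq: "q \<noteq> 0" "f a = of_int p / of_int q"
    using assms(2)[of a] by (metis Rats_cases' less_irrefl)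
  have "of_int (N * q) * f m \<in> \<int>" if "m \<in> insert a S" for m
  proof (cases "m = a")
    case True
    then have "of_int (N * q) * f m = of_int (N * p)"
      using pq by simp
    then show ?thesis
      by (metis Ints_of_int)
  next
    case False
    with that have "m \<in> S"
      by simp
    from Ints_mult[OF Ints_of_int N(2)[OF this]] have "of_int q * (of_int N * f m) \<in> \<int>" .
    then show ?thesis
      by (simp add: mult_ac)
  qed
  with N(1) pq(1) show ?case
    by (intro exI[of _ "N * q"]) auto
qed


section \<open>Evaluation over the ultrapower\<close>

lemma zero_hyperreal: "\<zero>\<^bsub>hyperreal U\<^esub> = hyperreal_class U (\<lambda>n. 0)"
proof -
  have "ring (ring_of_type_algebra :: (nat \<Rightarrow> real) ring)" "ring (hyperreal U)"
    using cring_hyperreal by (auto intro: ring_from_type_algebra cring.axioms(1))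
  then have "hyperreal_class U \<zero>\<^bsub>ring_of_type_algebra\<^esub> = \<zero>\<^bsub>hyperreal U\<^esub>"
    by (intro ring_hom_zero[OF hyperreal_class_ring_hom])
  then show ?thesis
    by (simp add: ring_of_type_algebra_def zero_fun_def)
qed

text \<open>
  Both sides are images of one value in the ring of real sequences: the left one under the class
  map, the terms of the right one under evaluation at an index. Finiteness of the support is needed
  uniformly in \<open>n\<close>.
\<close>

lemma error_poly_class:
  fixes p :: "'s::finite multiset \<Rightarrow> nat \<Rightarrow> real"
  assumes fin: "finite {m. p m \<noteq> (\<lambda>n. 0)}"
  shows "error_poly U \<theta> (\<lambda>m. hyperreal_class U (p m)) =
    hyperreal_class U (\<lambda>n. indexed_value ring_of_type_algebra (\<lambda>i. \<theta> $ i) (\<lambda>m. p m n))"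
proof -
  let ?A = "ring_of_type_algebra :: (nat \<Rightarrow> real) ring"
  let ?R = "ring_of_type_algebra :: real ring"
  let ?V = "indexed_value ?A (\<lambda>i n. \<theta> $ i) p"
  have carr: "a \<in> carrier ?A" for a
    by (simp add: ring_of_type_algebra_def)
  have fin': "finite {m. p m \<noteq> \<zero>\<^bsub>?A\<^esub>}"
    using fin by (simp add: ring_of_type_algebra_def zero_fun_def)
  interpret cls: ring_hom_cring ?A "hyperreal U" "hyperreal_class U"
    by (intro ring_hom_cring.intro ring_hom_cring_axioms.intro cring_from_type_algebra cring_hyperreal hyperreal_class_ring_hom)
  have "?V n = indexed_value ?R (\<lambda>i. \<theta> $ i) (\<lambda>m. p m n)" for n
  proof -
    have hom: "(\<lambda>f. f n) \<in> ring_hom ?A ?R"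
      by (rule ring_hom_memI) (simp_all add: ring_of_type_algebra_def)
    interpret ev: ring_hom_cring ?A ?R "\<lambda>f. f n"
      by (intro ring_hom_cring.intro ring_hom_cring_axioms.intro cring_from_type_algebra hom)
    show ?thesis
      by (rule ev.indexed_value_hom[OF fin' carr carr])
  qed
  then have "?V = (\<lambda>n. indexed_value ?R (\<lambda>i. \<theta> $ i) (\<lambda>m. p m n))"
    by blast
  then show ?thesis
    using cls.indexed_value_hom[OF fin' carr carr, of "\<lambda>i n. \<theta> $ i"]
    by (simp add: error_poly_def hyperreal_of_real_def)
qed

lemma hyperint_polys_iff:
  "F \<in> hyperint_polys U \<longleftrightarrow> finite {m. F m \<noteq> \<zero>\<^bsub>hyperreal U\<^esub>} \<and> (\<forall>m. F m \<in> hyperint U)"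
  unfolding hyperint_polys_def
  by (rule ring.indexed_pset_UNIV_iff[OF cring.axioms(1)[OF cring_hyperreal] subring_hyperint])

text \<open>
  A zero coefficient is represented by the zero sequence, so that the representatives have finite
  support too.
\<close>

lemma hyperint_polys_representatives:
  assumes "F \<in> hyperint_polys U"
  obtains p :: "'s multiset \<Rightarrow> nat \<Rightarrow> real"
  where "finite {m. p m \<noteq> (\<lambda>n. 0)}" "\<And>m n. p m n \<in> \<int>" "F = (\<lambda>m. hyperreal_class U (p m))"
proof -
  have "\<exists>f. F m = hyperreal_class U f \<and> (\<forall>n. f n \<in> \<int>) \<and>
      (F m = \<zero>\<^bsub>hyperreal U\<^esub> \<longrightarrow> f = (\<lambda>n. 0))" for m
  proof (cases "F m = \<zero>\<^bsub>hyperreal U\<^esub>")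
    case True
    then show ?thesis
      by (intro exI[of _ "\<lambda>n. 0"]) (simp add: zero_hyperreal)
  next
    case False
    have "F m \<in> hyperint U"
      using assms by (simp add: hyperint_polys_iff)
    then obtain k :: "nat \<Rightarrow> int" where "F m = hyperreal_class U (\<lambda>n. of_int (k n))"
      by (auto simp: hyperint_def)
    with False show ?thesis
      by (intro exI[of _ "\<lambda>n. of_int (k n)"]) simp
  qed
  then obtain p where p: "\<And>m. F m = hyperreal_class U (p m)" "\<And>m n. p m n \<in> \<int>"
    "\<And>m. F m = \<zero>\<^bsub>hyperreal U\<^esub> \<Longrightarrow> p m = (\<lambda>n. 0)"
    by metis
  show thesis
  proof
    have "{m. p m \<noteq> (\<lambda>n. 0)} \<subseteq> {m. F m \<noteq> \<zero>\<^bsub>hyperreal U\<^esub>}"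
      using p(3) by blast
    then show "finite {m. p m \<noteq> (\<lambda>n. 0)}"
      using assms by (auto simp: hyperint_polys_iff intro: finite_subset)
  qed (use p in auto)
qed

lemma zero_infinitesimal:
  assumes "U \<noteq> bot"
  shows "hyperreal_class U (\<lambda>n. 0) \<in> infinitesimals U"
proof -
  have less: "hyperreal_less U (hyperreal_of_real U a) (hyperreal_of_real U b)" if "a < b" for a b
    using that unfolding hyperreal_less_def hyperreal_of_real_def hyperreal_class_def'
    by (intro bexI[of _ "\<lambda>n. a"] bexI[of _ "\<lambda>n. b"]) auto
  have "hyperreal_class U (\<lambda>n. 0) = hyperreal_of_real U 0"
    by (simp add: hyperreal_of_real_def)
  then show ?thesis
    by (auto simp: infinitesimals_def carrier_hyperreal less)
qed


section \<open>Algebraic independence and injectivity of the error map\<close>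

theorem proposition14:
  fixes U :: "nat filter" and \<theta> :: "real ^ 's"
  assumes "nonprincipal_ultrafilter U"
  shows "algebraically_independent (ring_of_type_algebra :: real ring) \<rat> UNIV (\<lambda>i. \<theta> $ i)
     \<longleftrightarrow> inj_on (error_poly U \<theta>) (diophantine_polys U \<theta>)"
proof
  let ?R = "ring_of_type_algebra :: real ring"
  let ?val = "indexed_value ?R (\<lambda>i. \<theta> $ i)"
  interpret R: cring ?R
    by (rule cring_from_type_algebra)
  have carr: "a \<in> carrier ?R" for a
    by (simp add: ring_of_type_algebra_def)
  have zeroR: "\<zero>\<^bsub>?R\<^esub> = 0" and multR: "a \<otimes>\<^bsub>?R\<^esub> b = a * b" for a b
    by (simp_all add: ring_of_type_algebra_def)
  have pset: "P \<in> R.indexed_pset UNIV \<rat> \<longleftrightarrow> finite {m. P m \<noteq> 0} \<and> (\<forall>m. P m \<in> \<rat>)"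
    for P :: "'s multiset \<Rightarrow> real"
    using R.indexed_pset_UNIV_iff[OF subring_Rats, of P] by (simp add: zeroR)
  {
    assume "algebraically_independent ?R \<rat> UNIV (\<lambda>i. \<theta> $ i)"
    then have inj: "inj_on ?val (R.indexed_pset UNIV \<rat>)"
      by (intro R.algebraically_independent_imp_inj[OF subring_Rats carr])
    show "inj_on (error_poly U \<theta>) (diophantine_polys U \<theta>)"
    proof (rule inj_onI)
      fix F G
      assume "F \<in> diophantine_polys U \<theta>" "G \<in> diophantine_polys U \<theta>"
      then have FG: "F \<in> hyperint_polys U" "G \<in> hyperint_polys U"
        by (auto simp: diophantine_polys_def)
      obtain p where p: "finite {m. p m \<noteq> (\<lambda>n. 0)}" "\<And>m n. p m n \<in> \<int>"
        "F = (\<lambda>m. hyperreal_class U (p m))"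
        using hyperint_polys_representatives[OF FG(1)] by blast
      obtain q where q: "finite {m. q m \<noteq> (\<lambda>n. 0)}" "\<And>m n. q m n \<in> \<int>"
        "G = (\<lambda>m. hyperreal_class U (q m))"
        using hyperint_polys_representatives[OF FG(2)] by blast
      have slice: "(\<lambda>m. r m n) \<in> R.indexed_pset UNIV \<rat>"
        if "finite {m. r m \<noteq> (\<lambda>n. 0)}" "\<And>m n. r m n \<in> \<int>"
        for r :: "'s multiset \<Rightarrow> nat \<Rightarrow> real" and n
      proof -
        have "finite {m. r m n \<noteq> 0}"
          by (rule finite_subset[OF _ that(1)]) auto
        then show ?thesis
          using that(2) Ints_subset_Rats by (auto simp: pset)
      qed
      assume "error_poly U \<theta> F = error_poly U \<theta> G"
      then have "eventually (\<lambda>n. ?val (\<lambda>m. p m n) = ?val (\<lambda>m. q m n)) U"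
        by (simp add: p(3) q(3) error_poly_class[OF p(1)] error_poly_class[OF q(1)]
            hyperreal_class_eq_iff)
      then have "eventually (\<lambda>n. (\<lambda>m. p m n) = (\<lambda>m. q m n)) U"
        by (rule eventually_mono) (use inj_onD[OF inj] slice[OF p(1,2)] slice[OF q(1,2)] in blast)
      then have "eventually (\<lambda>n. p m n = q m n) U" for m
        by (rule eventually_mono) (rule fun_cong)
      then have "hyperreal_class U (p m) = hyperreal_class U (q m)" for m
        by (simp add: hyperreal_class_eq_iff)
      then show "F = G"
        by (simp add: p(3) q(3))
    qed
  }
  {
    assume inj: "inj_on (error_poly U \<theta>) (diophantine_polys U \<theta>)"
    have U: "U \<noteq> bot"
      using assms by (simp add: nonprincipal_ultrafilter_def)
    show "algebraically_independent ?R \<rat> UNIV (\<lambda>i. \<theta> $ i)"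
      unfolding algebraically_independent_def
    proof (intro ballI impI)
      fix P :: "'s multiset \<Rightarrow> real"
      assume "P \<in> R.indexed_pset UNIV \<rat>" and val: "?val P = \<zero>\<^bsub>?R\<^esub>"
      then have fin: "finite {m. P m \<noteq> 0}" and rat: "\<And>m. P m \<in> \<rat>"
        by (auto simp: pset)
      obtain N :: int where N: "N \<noteq> 0" "\<forall>m\<in>{m. P m \<noteq> 0}. of_int N * P m \<in> \<int>"
        using finite_rats_common_denominator[of _ P, OF fin rat] by blast
      define Q where "Q m = of_int N * P m" for m
      have Q_int: "Q m \<in> \<int>" for m
        using N(2) by (cases "P m = 0") (auto simp: Q_def)
      have finQ: "finite {m. Q m \<noteq> 0}"
        using fin N(1) by (simp add: Q_def)
      have "?val Q = of_int N * ?val P"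
        using R.indexed_value_smult[of P "of_int N" "\<lambda>i. \<theta> $ i", OF _ carr carr carr] fin
        by (simp add: zeroR multR Q_def[abs_def])
      then have valQ: "?val Q = 0"
        by (simp add: val zeroR)
      have val0: "?val (\<lambda>m. 0) = 0"
        using R.indexed_value_smult[of P 0 "\<lambda>i. \<theta> $ i", OF _ carr carr carr] fin
        by (simp add: zeroR multR)
      define lift :: "('s multiset \<Rightarrow> real) \<Rightarrow> 's multiset \<Rightarrow> (nat \<Rightarrow> real) set"
        where "lift r = (\<lambda>m. hyperreal_class U (\<lambda>n. r m))" for r
      have lift: "error_poly U \<theta> (lift r) = hyperreal_class U (\<lambda>n. 0)"
        "lift r \<in> diophantine_polys U \<theta>"
        if r: "finite {m. r m \<noteq> 0}" "\<And>m. r m \<in> \<int>" "?val r = 0" for r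
      proof -
        have "finite {m. (\<lambda>n::nat. r m) \<noteq> (\<lambda>n. 0)}"
          by (rule finite_subset[OF _ r(1)]) auto
        then show err: "error_poly U \<theta> (lift r) = hyperreal_class U (\<lambda>n. 0)"
          unfolding lift_def by (subst error_poly_class) (simp_all add: r(3))
        have "finite {m. lift r m \<noteq> \<zero>\<^bsub>hyperreal U\<^esub>}"
          by (rule finite_subset[OF _ r(1)]) (auto simp: lift_def zero_hyperreal)
        moreover have "lift r m \<in> hyperint U" for m
        proof -
          obtain k where "r m = of_int k"
            using r(2)[of m] by (auto elim: Ints_cases)
          then show ?thesis
            unfolding lift_def hyperint_def by (intro CollectI exI[of _ "\<lambda>n. k"]) simp
        qed
        ultimately show "lift r \<in> diophantine_polys U \<theta>"
          using zero_infinitesimal[OF U] by (simp add: diophantine_polys_def hyperint_polys_iff err)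
      qed
      have "lift Q = lift (\<lambda>m. 0)"
        using inj lift[OF finQ Q_int valQ] lift[of "\<lambda>m. 0"] val0
        by (intro inj_onD[OF inj]) simp_all
      then have "lift Q m = lift (\<lambda>m. 0) m" for m
        by simp
      \<comment> \<open>A constant sequence that vanishes almost everywhere is zero because \<open>U\<close> is proper.\<close>
      then have "Q m = 0" for m
        using U by (simp add: lift_def hyperreal_class_eq_iff eventually_const_iff)
      then show "P = (\<lambda>m. \<zero>\<^bsub>?R\<^esub>)"
        using N(1) by (simp add: Q_def zeroR fun_eq_iff)
    qed
  }
qed

end
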